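(* Consider an antenna array of $M$ antennas as described in the context, each antenna having radiation resistance $R_{\rm rad}>0$ and ohmic loss resistance $r_{\rm loss}\ge 0$, with impedance coupling matrix $\mathbf{Z}\in\mathbb{R}^{M\times M}$. Let $\mathbf{h}_u\in\mathbb{C}^M$ be the channel vector of the $u$-th user and let $\mathbf{w}_u\in\mathbb{C}^M\setminus\{\mathbf{0}\}$ be a precoding vector. Then the power gain $G_u=\eta D_u$ of user $u$ taking into account the ohmic loss equals $$G_u=\frac{\mathbf{w}_u^T\mathbf{h}_u\mathbf{h}_u^H\mathbf{w}_u^*}{\mathbf{w}_u^T\mathbf{Z}_R\mathbf{w}_u^*},\qquad\text{where}\quad \mathbf{Z}_R=\mathbf{Z}+\frac{r_{\rm loss}}{R_{\rm rad}}\mathbf{I}_M.$$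
   Context: Notation: $(\cdot)^*$, $(\cdot)^T$, $(\cdot)^H$ denote entrywise complex conjugate, transpose, and conjugate transpose; $\mathbf{I}_M$ is the $M\times M$ identity matrix. The array consists of $M$ isotropic antennas placed on a line with uniform spacing $d$, $0<d<\lambda/2$, where $\lambda>0$ is the wavelength and $k=2\pi/\lambda$. Its impedance coupling matrix $\mathbf{Z}=(z_{mn})$ has entries $z_{mm}=1$ and $z_{mn}=\frac{\sin[kd(n-m)]}{kd(n-m)}$ for $n\ne m$; it is real symmetric positive definite. The lossless power gain of user $u$ is $D_u=\dfrac{\mathbf{w}_u^T\mathbf{h}_u\mathbf{h}_u^H\mathbf{w}_u^*}{\mathbf{w}_u^T\mathbf{Z}\mathbf{w}_u^*}$. The radiated power is $P_{\rm rad}=\frac12\mathbf{w}_u^T(R_{\rm rad}\mathbf{Z})\mathbf{w}_u^*$, the loss power is $P_{\rm loss}=\frac12\mathbf{w}_u^T(r_{\rm loss}\mathbf{I}_M)\mathbf{w}_u^*$, the radiation efficiency is $\eta=\dfrac{P_{\rm rad}}{P_{\rm rad}+P_{\rm loss}}$, and the power gain with ohmic loss is defined as $G_u=\eta D_u$. *)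

theory Defs
  imports Complex_Main "Jordan_Normal_Form.Matrix"
begin

(* Antennas are numbered 0, ..., M - 1; only differences of the indices enter.
   Each entry is the value at k d (n - m) of the sinc function sin x / x, extended by 1 at 0. *)
definition coupling_matrix :: "nat \<Rightarrow> real \<Rightarrow> real \<Rightarrow> real mat" where
  "coupling_matrix M wavelength d =
     (let k = 2 * pi / wavelength
      in mat M M (\<lambda>(m, n). if n = m then 1
           else sin (k * d * (real n - real m)) / (k * d * (real n - real m))))"

(* w^T A w^*.  The operation scalar_prod is bilinear (no conjugation), so
   the only conjugation is the one on the right-hand argument. *)
definition herm_form :: "complex vec \<Rightarrow> complex mat \<Rightarrow> complex" where
  "herm_form w A = w \<bullet> (A *\<^sub>v conjugate w)"

(* h h^H, the product of a column and a row matrix *)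
definition outer_conj :: "complex vec \<Rightarrow> complex mat" where
  "outer_conj h = mat_of_cols (dim_vec h) [h] * mat_of_rows (dim_vec h) [conjugate h]"

(* Gains and powers are kept as complex numbers, exactly as the quotients of forms
   w^T A w^* are written.  They are in fact real, so no real part is taken. *)
definition lossless_gain :: "real mat \<Rightarrow> complex vec \<Rightarrow> complex vec \<Rightarrow> complex" where
  "lossless_gain Z h w =
     herm_form w (outer_conj h) / herm_form w (map_mat complex_of_real Z)"

definition radiated_power :: "real \<Rightarrow> real mat \<Rightarrow> complex vec \<Rightarrow> complex" where
  "radiated_power R_rad Z w =
     1 / 2 * herm_form w (map_mat complex_of_real (R_rad \<cdot>\<^sub>m Z))"

definition loss_power :: "real \<Rightarrow> complex vec \<Rightarrow> complex" where
  "loss_power r_loss w =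
     1 / 2 * herm_form w (map_mat complex_of_real (r_loss \<cdot>\<^sub>m 1\<^sub>m (dim_vec w)))"

definition radiation_efficiency ::
    "real \<Rightarrow> real \<Rightarrow> real mat \<Rightarrow> complex vec \<Rightarrow> complex" where
  "radiation_efficiency R_rad r_loss Z w =
     radiated_power R_rad Z w / (radiated_power R_rad Z w + loss_power r_loss w)"

definition power_gain ::
    "real \<Rightarrow> real \<Rightarrow> real mat \<Rightarrow> complex vec \<Rightarrow> complex vec \<Rightarrow> complex" where
  "power_gain R_rad r_loss Z h w =
     radiation_efficiency R_rad r_loss Z w * lossless_gain Z h w"

end

theory Submission
  imports Defs
begin

text \<open>
  The identity amounts to cancelling the common factor \<open>w\<^sup>T Z w\<^sup>*\<close>, so its content is that this
  factor does not vanish. With \<open>a = k d\<close> and \<open>p(z) = \<Sum> w\<^sub>m z\<^sup>m\<close>, the form \<open>w\<^sup>T Z w\<^sup>*\<close> is the value at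
  \<open>t = 1\<close> of a function that vanishes at \<open>t = 0\<close> and has derivative
  \<open>(\<bar>p(e\<^sup>i\<^sup>a\<^sup>t)\<bar>\<^sup>2 + \<bar>p(e\<^sup>-\<^sup>i\<^sup>a\<^sup>t)\<bar>\<^sup>2) / 2 \<ge> 0\<close>. A nonzero polynomial cannot vanish on a whole arc of the unit
  circle, so the function is positive at \<open>t = 1\<close>.
\<close>

lemma cmod_square_cis_sum:
  fixes c :: "nat \<Rightarrow> complex" and s :: real
  shows "(cmod (\<Sum>m<M. c m * cis (s * real m)))\<^sup>2 =
    (\<Sum>m<M. \<Sum>n<M. Re (c m * cnj (c n)) * cos (s * (real n - real m))
      + Im (c m * cnj (c n)) * sin (s * (real n - real m)))"
proof -
  let ?p = "\<Sum>m<M. c m * cis (s * real m)"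
  have "complex_of_real ((cmod ?p)\<^sup>2) = ?p * cnj ?p"
    by (rule complex_norm_square)
  also have "\<dots> = (\<Sum>m<M. \<Sum>n<M. c m * cnj (c n) * cis (s * (real m - real n)))"
    by (simp add: sum_product cis_cnj cis_mult cis_divide [symmetric] algebra_simps)
  finally have "(cmod ?p)\<^sup>2 = Re (\<Sum>m<M. \<Sum>n<M. c m * cnj (c n) * cis (s * (real m - real n)))"
    by (metis Re_complex_of_real)
  also have "\<dots> = (\<Sum>m<M. \<Sum>n<M. Re (c m * cnj (c n) * cis (s * (real m - real n))))"
    by (simp only: Re_sum)
  also have "\<dots> = (\<Sum>m<M. \<Sum>n<M. Re (c m * cnj (c n)) * cos (s * (real n - real m))
      + Im (c m * cnj (c n)) * sin (s * (real n - real m)))"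
  proof (intro sum.cong refl)
    fix m n
    \<comment> \<open>The product \<open>c m * cnj (c n)\<close> carries the phase
      \<open>m - n\<close>, whereas the coupling entries use \<open>n - m\<close>; the sign change
      turns the real part of the product into a sum with a plus before the sine.\<close>
    have "s * (real m - real n) = - (s * (real n - real m))"
      by (simp add: algebra_simps)
    then show "Re (c m * cnj (c n) * cis (s * (real m - real n))) =
        Re (c m * cnj (c n)) * cos (s * (real n - real m))
        + Im (c m * cnj (c n)) * sin (s * (real n - real m))"
      by (simp only: times_complex.simps cis.simps cos_minus sin_minus mult_minus_right diff_minus_eq_add)
  qed
  finally show ?thesis .
qed

text \<open>Passing from \<open>s\<close> to \<open>- s\<close> keeps the cosines of
  \<open>cmod_square_cis_sum\<close> and flips its sines, so averaging the two expansions leaves the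
  cosines alone. This makes the nonnegativity of the cosine form visible.\<close>

lemma cos_form_eq:
  fixes c :: "nat \<Rightarrow> complex" and s :: real
  shows "(\<Sum>m<M. \<Sum>n<M. Re (c m * cnj (c n)) * cos (s * (real n - real m))) =
    ((cmod (\<Sum>m<M. c m * cis (s * real m)))\<^sup>2
      + (cmod (\<Sum>m<M. c m * cis (- s * real m)))\<^sup>2) / 2"
  unfolding cmod_square_cis_sum
  by (simp add: sum.distrib sum_subtractf sum_distrib_left [symmetric] del: times_complex.simps)

lemma cis_sum_nonzero_on_arc:
  fixes c :: "nat \<Rightarrow> complex" and a :: real
  assumes "0 < a" "a \<le> pi" "i < M" "c i \<noteq> 0"
  obtains t where "0 < t" "t < 1" "(\<Sum>m<M. c m * cis (a * t * real m)) \<noteq> 0"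
proof (rule ccontr)
  assume "\<not> thesis"
  with that have zero: "(\<Sum>m<M. c m * cis (a * t * real m)) = 0" if "t \<in> {0<..<1}" for t
    using \<open>t \<in> {0<..<1}\<close> by auto
  obtain N where N: "M = Suc N"
    using assms(3) by (cases M) auto
  \<comment> \<open>As \<open>a \<le> pi\<close>, the angles \<open>a * t\<close> stay in
    \<open>{0..pi}\<close>, where cosine is injective; so the arc supplies infinitely many distinct
    roots.\<close>
  have "inj_on (\<lambda>t. cis (a * t)) {0<..<1}"
  proof (rule inj_onI)
    fix x y :: real
    assume x: "x \<in> {0<..<1}" and y: "y \<in> {0<..<1}" and "cis (a * x) = cis (a * y)"
    then have "cos (a * x) = cos (a * y)"
      by (simp add: complex_eq_iff)
    moreover have "a * t \<in> {0..pi}" if "t \<in> {0<..<1}" for t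
      using that assms(1,2) mult_mono [of a pi t 1] by auto
    ultimately have "a * x = a * y"
      using x y cos_inj_pi by (metis atLeastAtMost_iff)
    then show "x = y"
      using assms(1) by simp
  qed
  then have "infinite ((\<lambda>t. cis (a * t)) ` {0<..<1::real})"
    by (simp add: finite_image_iff)
  moreover have "(\<lambda>t. cis (a * t)) ` {0<..<1} \<subseteq> {z. (\<Sum>m\<le>N. c m * z ^ m) = 0}"
  proof clarify
    fix t :: real
    assume "t \<in> {0<..<1}"
    then have "(\<Sum>m<M. c m * cis (a * t * real m)) = 0"
      by (rule zero)
    then show "(\<Sum>m\<le>N. c m * cis (a * t) ^ m) = 0"
      by (simp add: N lessThan_Suc_atMost DeMoivre mult.commute)
  qed
  ultimately have "infinite {z. (\<Sum>m\<le>N. c m * z ^ m) = 0}"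
    using finite_subset by blast
  then show False
    using polyfun_finite_roots [of c N] assms(3,4) N by auto
qed

lemma sinc_form_pos:
  fixes c :: "nat \<Rightarrow> complex" and a :: real
  assumes "0 < a" "a \<le> pi" "i < M" "c i \<noteq> 0"
  shows "0 < (\<Sum>m<M. \<Sum>n<M. Re (c m * cnj (c n)) *
    (if n = m then 1 else sin (a * (real n - real m)) / (a * (real n - real m))))"
proof -
  \<comment> \<open>Each entry of \<open>G\<close> is the antiderivative in \<open>t\<close>,
    vanishing at 0, of \<open>cos (a * t * (real n - real m))\<close>; on the diagonal the cosine is
    1, which gives \<open>t\<close>. The claim is \<open>0 < G 1\<close>.\<close>
  define G where "G t = (\<Sum>m<M. \<Sum>n<M. Re (c m * cnj (c n)) *
    (if n = m then t else sin (a * t * (real n - real m)) / (a * (real n - real m))))" for t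
  define g where "g t = (\<Sum>m<M. \<Sum>n<M. Re (c m * cnj (c n)) * cos (a * t * (real n - real m)))" for t
  have deriv: "(G has_real_derivative g t) (at t)" for t
    unfolding G_def g_def
  proof (intro DERIV_sum DERIV_cmult)
    fix m n
    show "((\<lambda>t. if n = m then t else sin (a * t * (real n - real m)) / (a * (real n - real m)))
        has_real_derivative cos (a * t * (real n - real m))) (at t)"
      using assms(1) by (cases "n = m") (auto intro!: derivative_eq_intros)
  qed
  have g: "g t = ((cmod (\<Sum>m<M. c m * cis (a * t * real m)))\<^sup>2
      + (cmod (\<Sum>m<M. c m * cis (- (a * t) * real m)))\<^sup>2) / 2" for t
    unfolding g_def by (rule cos_form_eq)
  have mono: "G x \<le> G y" if "x \<le> y" for x y
    using that
  proof (rule DERIV_nonneg_imp_nondecreasing)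
    fix t show "\<exists>D. (G has_real_derivative D) (at t) \<and> 0 \<le> D"
      using deriv [of t] by (auto simp: g)
  qed
  obtain t where t: "0 < t" "t < 1" "(\<Sum>m<M. c m * cis (a * t * real m)) \<noteq> 0"
    using cis_sum_nonzero_on_arc assms by metis
  then have "0 < g t"
    unfolding g by (intro divide_pos_pos add_pos_nonneg) auto
  then obtain e where "0 < e" and e: "\<And>h. 0 < h \<Longrightarrow> h < e \<Longrightarrow> G t < G (t + h)"
    using DERIV_pos_inc_right [OF deriv] by blast
  \<comment> \<open>The positive derivative at \<open>t\<close> gives strict growth only within
    distance \<open>e\<close>. Halving \<open>e\<close> keeps \<open>h < e\<close>, and the bound
    \<open>1 - t\<close> keeps \<open>t + h \<le> 1\<close>; monotonicity covers the rest of the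
    unit interval.\<close>
  define h where "h = min (e / 2) (1 - t)"
  have "G 0 \<le> G t"
    using t by (intro mono) simp
  also have "\<dots> < G (t + h)"
    using \<open>0 < e\<close> t(2) by (intro e) (auto simp: h_def)
  also have "\<dots> \<le> G 1"
    by (intro mono) (simp add: h_def)
  finally show ?thesis
    by (simp add: G_def cong: if_cong)
qed

lemma herm_form_eq_sum:
  assumes "w \<in> carrier_vec M" "A \<in> carrier_mat M M"
  shows "herm_form w A = (\<Sum>m<M. \<Sum>n<M. w $ m * cnj (w $ n) * A $$ (m, n))"
  using assms
  by (simp add: herm_form_def scalar_prod_def sum_distrib_left atLeast0LessThan mult_ac)

lemma herm_form_add:
  assumes "w \<in> carrier_vec M" "A \<in> carrier_mat M M" "B \<in> carrier_mat M M"
  shows "herm_form w (A + B) = herm_form w A + herm_form w B"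
  using assms by (simp add: herm_form_eq_sum [of _ M] sum.distrib distrib_left)

lemma herm_form_smult:
  assumes "w \<in> carrier_vec M" "A \<in> carrier_mat M M"
  shows "herm_form w (x \<cdot>\<^sub>m A) = x * herm_form w A"
  using assms by (simp add: herm_form_eq_sum [of _ M] sum_distrib_left mult_ac)

lemma coupling_matrix_carrier [simp]: "coupling_matrix M wavelength d \<in> carrier_mat M M"
  by (simp add: coupling_matrix_def Let_def)

text \<open>The entries are real, so the real part falls on the factors
  \<open>w $ m * cnj (w $ n)\<close> and \<open>sinc_form_pos\<close> applies. A positive real part
  is enough to divide by the form.\<close>

lemma Re_herm_form_coupling_matrix_pos:
  assumes "0 < wavelength" "0 < d" "d < wavelength / 2"
    and w: "w \<in> carrier_vec M" "w \<noteq> 0\<^sub>v M"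
  shows "0 < Re (herm_form w (map_mat complex_of_real (coupling_matrix M wavelength d)))"
proof -
  \<comment> \<open>This is \<open>k d\<close>; spacing below half a wavelength is what keeps it
    below \<open>pi\<close>.\<close>
  define a where "a = 2 * pi / wavelength * d"
  have a: "0 < a" "a \<le> pi"
    using assms(1-3) by (simp_all add: a_def field_simps)
  obtain i where i: "i < M" "w $ i \<noteq> 0"
    using w by (metis carrier_vecD eq_vecI index_zero_vec)
  have "Re (herm_form w (map_mat complex_of_real (coupling_matrix M wavelength d))) =
    (\<Sum>m<M. \<Sum>n<M. Re (w $ m * cnj (w $ n)) *
      (if n = m then 1 else sin (a * (real n - real m)) / (a * (real n - real m))))"
    unfolding herm_form_eq_sum [OF w(1) map_carrier_mat [THEN iffD2, OF coupling_matrix_carrier]] Re_sum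
    by (intro sum.cong refl) (simp add: coupling_matrix_def Let_def a_def)
  also have "\<dots> > 0"
    using a i by (rule sinc_form_pos [where c = "\<lambda>m. w $ m"])
  finally show ?thesis .
qed

theorem proposition1:
  fixes M :: nat and wavelength d R_rad r_loss :: real
    and Z Z_R :: "real Matrix.mat" and h w :: "complex Matrix.vec"
  assumes "0 < wavelength" and "0 < d" and "d < wavelength / 2"
    and "0 < R_rad" and "0 \<le> r_loss"
    and "h \<in> carrier_vec M" and "w \<in> carrier_vec M" and "w \<noteq> 0\<^sub>v M"
    and "Z = coupling_matrix M wavelength d"
    and "Z_R = Z + (r_loss / R_rad) \<cdot>\<^sub>m 1\<^sub>m M"
  shows "power_gain R_rad r_loss Z h w =
    herm_form w (outer_conj h) / herm_form w (map_mat complex_of_real Z_R)"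
proof -
  have smult: "map_mat complex_of_real (x \<cdot>\<^sub>m A) = complex_of_real x \<cdot>\<^sub>m map_mat complex_of_real A" for x A
    by (rule eq_matI) auto
  have Z: "map_mat complex_of_real Z \<in> carrier_mat M M"
    using assms(9) by simp
  have I: "map_mat complex_of_real (1\<^sub>m M) \<in> carrier_mat M M"
    by simp
  define X where "X = herm_form w (map_mat complex_of_real Z)"
  define Y where "Y = herm_form w (map_mat complex_of_real (1\<^sub>m M))"
  have "X \<noteq> 0"
    using Re_herm_form_coupling_matrix_pos [OF assms(1-3,7,8)] assms(9) by (auto simp: X_def)
  have rad: "radiated_power R_rad Z w = R_rad * X / 2"
    by (simp add: radiated_power_def smult herm_form_smult [OF assms(7) Z] X_def)
  have loss: "loss_power r_loss w = r_loss * Y / 2"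
    using assms(7) by (simp add: loss_power_def smult herm_form_smult [OF assms(7) I] Y_def)
  have "map_mat complex_of_real Z_R =
      map_mat complex_of_real Z + (r_loss / R_rad) \<cdot>\<^sub>m map_mat complex_of_real (1\<^sub>m M)"
    using Z assms(10) by (intro eq_matI) auto
  then have "herm_form w (map_mat complex_of_real Z_R) = X + r_loss / R_rad * Y"
    using herm_form_add [OF assms(7) Z smult_carrier_mat [OF I]]
    by (simp add: herm_form_smult [OF assms(7) I] X_def Y_def)
  \<comment> \<open>Factoring out \<open>1 / R_rad\<close> exposes twice the total power, the
    denominator of the efficiency up to the common factor 1/2.\<close>
  also have "\<dots> = (R_rad * X + r_loss * Y) / R_rad"
    using assms(4) by (simp add: field_simps)
  finally have ZR: "herm_form w (map_mat complex_of_real Z_R) = (R_rad * X + r_loss * Y) / R_rad" .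
  \<comment> \<open>The \<open>X\<close> in the numerator of the efficiency cancels the denominator
    of the lossless gain.\<close>
  show ?thesis
    unfolding power_gain_def radiation_efficiency_def lossless_gain_def rad loss ZR
      X_def [symmetric]
    using \<open>X \<noteq> 0\<close> by (simp add: add_divide_distrib [symmetric])
qed

end
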